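(* There is an algorithm which, given the number of customers $T\ge 1$, a universe $\mathcal{N}=\{1,\dots,n\}$ of products with preference weights $v_1,\dots,v_n>0$, and an arbitrary assortment $S\subseteq \mathcal{N}$, computes the expected maximum load $\mathbb{E}(M(S))$ in $O(n^2T^3)$ time.
   Context: Multinomial Logit (MNL) model: each product $i\in\mathcal{N}$ has preference weight $v_i>0$ and the no-purchase option $0$ has weight $1$. For an assortment $S\subseteq\mathcal{N}$ let $v(S)=\sum_{i\in S}v_i$, $\phi_i(S)=\frac{v_i}{1+v(S)}$ for $i\in S$, and $\phi_0(S)=\frac{1}{1+v(S)}$. When $S$ is offered to $T$ customers, each customer independently chooses option $i\in S\cup\{0\}$ with probability $\phi_i(S)$. The load $L_i(S)$ is the (random) number of customers choosing product $i$, and $M(S)=\max_{i\in S}L_i(S)$ is the maximum load (with $M(\emptyset)=0$). Running time is measured as the number of elementary arithmetic operations. *)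

theory Defs
  imports "HOL-Probability.Probability"
begin

section \<open>Expected maximum load under the Multinomial Logit model\<close>

text \<open>Products are positive naturals; the natural number 0 is the no-purchase option.\<close>

definition weight :: "(nat \<Rightarrow> real) \<Rightarrow> nat set \<Rightarrow> real" where
  "weight v S = (\<Sum>i\<in>S. v i)"

definition choice_prob :: "(nat \<Rightarrow> real) \<Rightarrow> nat set \<Rightarrow> nat \<Rightarrow> real" where
  "choice_prob v S i =
     (if i = 0 then 1 / (1 + weight v S)
      else if i \<in> S then v i / (1 + weight v S)
      else 0)"

definition choice_pmf :: "(nat \<Rightarrow> real) \<Rightarrow> nat set \<Rightarrow> nat pmf" where
  "choice_pmf v S = embed_pmf (choice_prob v S)"

text \<open>A choice profile \<open>X\<close> maps each customer in \<open>{1..T}\<close> to the option chosen; the second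
  argument of \<^const>\<open>Pi_pmf\<close> is the dummy value outside \<open>{1..T}\<close>, which the loads ignore.\<close>

definition choices_pmf :: "nat \<Rightarrow> (nat \<Rightarrow> real) \<Rightarrow> nat set \<Rightarrow> (nat \<Rightarrow> nat) pmf" where
  "choices_pmf T v S = Pi_pmf {1..T} 0 (\<lambda>_. choice_pmf v S)"

definition load :: "nat \<Rightarrow> (nat \<Rightarrow> nat) \<Rightarrow> nat \<Rightarrow> nat" where
  "load T X i = card {t \<in> {1..T}. X t = i}"

definition max_load :: "nat \<Rightarrow> nat set \<Rightarrow> (nat \<Rightarrow> nat) \<Rightarrow> nat" where
  "max_load T S X = (if S = {} then 0 else Max (load T X ` S))"

definition expected_max_load :: "nat \<Rightarrow> (nat \<Rightarrow> real) \<Rightarrow> nat set \<Rightarrow> real" where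
  "expected_max_load T v S =
     measure_pmf.expectation (choices_pmf T v S) (\<lambda>X. real (max_load T S X))"

text \<open>The side condition of \<^const>\<open>embed_pmf\<close> holds for all admissible data.\<close>

lemma pmf_choice_pmf:
  assumes "S \<subseteq> {1..n}" and "\<forall>i\<in>{1..n}. 0 < v i"
  shows "pmf (choice_pmf v S) i = choice_prob v S i"
  unfolding choice_pmf_def
proof (rule pmf_embed_pmf)
  have fin: "finite S" and S0: "0 \<notin> S"
    using assms(1) finite_subset by auto
  have pos: "0 < v j" if "j \<in> S" for j
    using assms that by auto
  have w: "0 \<le> weight v S"
    unfolding weight_def by (intro sum_nonneg less_imp_le pos)
  show nn: "0 \<le> choice_prob v S j" for j
    using w pos by (auto simp: choice_prob_def intro!: divide_nonneg_nonneg less_imp_le)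
  have sub: "{j. ennreal (choice_prob v S j) \<noteq> 0} \<subseteq> insert 0 S"
    by (auto simp: choice_prob_def split: if_splits)
  have "(\<integral>\<^sup>+ j. ennreal (choice_prob v S j) \<partial>count_space UNIV)
      = (\<Sum>j\<in>insert 0 S. ennreal (choice_prob v S j))"
    by (rule nn_integral_count_space') (use fin sub in auto)
  also have "\<dots> = ennreal (\<Sum>j\<in>insert 0 S. choice_prob v S j)"
    by (rule sum_ennreal) (use nn in auto)
  also have "(\<Sum>j\<in>insert 0 S. choice_prob v S j)
      = 1 / (1 + weight v S) + (\<Sum>j\<in>S. v j / (1 + weight v S))"
  proof -
    have "(\<Sum>j\<in>S. choice_prob v S j) = (\<Sum>j\<in>S. v j / (1 + weight v S))"
      using S0 by (intro sum.cong) (auto simp: choice_prob_def)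
    then show ?thesis
      using fin S0 by (simp add: choice_prob_def)
  qed
  also have "\<dots> = 1"
    using w by (simp add: sum_divide_distrib [symmetric] add_divide_distrib [symmetric]
        weight_def [symmetric])
  finally show "(\<integral>\<^sup>+ j. ennreal (choice_prob v S j) \<partial>count_space UNIV) = 1"
    by simp
qed


section \<open>A real random access machine with unit-cost operations\<close>

text \<open>The memory consists of named arrays of naturals and of reals; a scalar is the entry 0 of an
  array.  Naturals serve as input bits, counters and (computed) indices and only support addition
  and truncated subtraction.  Reals support the four arithmetic operations; there is no rounding
  and no conversion from reals to naturals.  As in HOL, a division by zero yields 0.  The only
  literals are naturals.\<close>

record state =
  nat_mem :: "string \<Rightarrow> nat \<Rightarrow> nat"
  real_mem :: "string \<Rightarrow> nat \<Rightarrow> real"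

datatype nexp =
    NConst nat
  | NRead string nexp
  | NAdd nexp nexp
  | NSub nexp nexp

datatype rexp =
    ROfNat nexp
  | RRead string nexp
  | RAdd rexp rexp
  | RSub rexp rexp
  | RMul rexp rexp
  | RDiv rexp rexp

datatype bexp =
    NLess nexp nexp
  | RLess rexp rexp
  | BNot bexp
  | BAnd bexp bexp

datatype com =
    Skip
  | NWrite string nexp nexp
  | RWrite string nexp rexp
  | Seq com com
  | Cond bexp com com
  | While bexp com

primrec nval :: "nexp \<Rightarrow> state \<Rightarrow> nat" where
  "nval (NConst k) s = k"
| "nval (NRead x e) s = nat_mem s x (nval e s)"
| "nval (NAdd e1 e2) s = nval e1 s + nval e2 s"
| "nval (NSub e1 e2) s = nval e1 s - nval e2 s"

primrec rval :: "rexp \<Rightarrow> state \<Rightarrow> real" where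
  "rval (ROfNat e) s = real (nval e s)"
| "rval (RRead x e) s = real_mem s x (nval e s)"
| "rval (RAdd e1 e2) s = rval e1 s + rval e2 s"
| "rval (RSub e1 e2) s = rval e1 s - rval e2 s"
| "rval (RMul e1 e2) s = rval e1 s * rval e2 s"
| "rval (RDiv e1 e2) s = rval e1 s / rval e2 s"

primrec bval :: "bexp \<Rightarrow> state \<Rightarrow> bool" where
  "bval (NLess e1 e2) s \<longleftrightarrow> nval e1 s < nval e2 s"
| "bval (RLess e1 e2) s \<longleftrightarrow> rval e1 s < rval e2 s"
| "bval (BNot b) s \<longleftrightarrow> \<not> bval b s"
| "bval (BAnd b1 b2) s \<longleftrightarrow> bval b1 s \<and> bval b2 s"

text \<open>Every node of an expression costs one unit: besides arithmetic operations and comparisons,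
  this also charges literals and memory accesses.\<close>

primrec ncost :: "nexp \<Rightarrow> nat" where
  "ncost (NConst k) = 1"
| "ncost (NRead x e) = 1 + ncost e"
| "ncost (NAdd e1 e2) = 1 + ncost e1 + ncost e2"
| "ncost (NSub e1 e2) = 1 + ncost e1 + ncost e2"

primrec rcost :: "rexp \<Rightarrow> nat" where
  "rcost (ROfNat e) = 1 + ncost e"
| "rcost (RRead x e) = 1 + ncost e"
| "rcost (RAdd e1 e2) = 1 + rcost e1 + rcost e2"
| "rcost (RSub e1 e2) = 1 + rcost e1 + rcost e2"
| "rcost (RMul e1 e2) = 1 + rcost e1 + rcost e2"
| "rcost (RDiv e1 e2) = 1 + rcost e1 + rcost e2"

primrec bcost :: "bexp \<Rightarrow> nat" where
  "bcost (NLess e1 e2) = 1 + ncost e1 + ncost e2"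
| "bcost (RLess e1 e2) = 1 + rcost e1 + rcost e2"
| "bcost (BNot b) = 1 + bcost b"
| "bcost (BAnd b1 b2) = 1 + bcost b1 + bcost b2"

definition nat_write :: "string \<Rightarrow> nat \<Rightarrow> nat \<Rightarrow> state \<Rightarrow> state" where
  "nat_write x i k s = s\<lparr>nat_mem := (nat_mem s)(x := (nat_mem s x)(i := k))\<rparr>"

definition real_write :: "string \<Rightarrow> nat \<Rightarrow> real \<Rightarrow> state \<Rightarrow> state" where
  "real_write x i r s = s\<lparr>real_mem := (real_mem s)(x := (real_mem s x)(i := r))\<rparr>"

text \<open>\<open>exec c s k s'\<close>: started in \<open>s\<close>, the program \<open>c\<close> halts in \<open>s'\<close> after \<open>k\<close> operations.\<close>

inductive exec :: "com \<Rightarrow> state \<Rightarrow> nat \<Rightarrow> state \<Rightarrow> bool" where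
  exec_Skip: "exec Skip s 1 s"
| exec_NWrite:
    "exec (NWrite x i e) s (1 + ncost i + ncost e) (nat_write x (nval i s) (nval e s) s)"
| exec_RWrite:
    "exec (RWrite x i e) s (1 + ncost i + rcost e) (real_write x (nval i s) (rval e s) s)"
| exec_Seq:
    "exec c1 s k1 s1 \<Longrightarrow> exec c2 s1 k2 s2 \<Longrightarrow> exec (Seq c1 c2) s (1 + k1 + k2) s2"
| exec_CondTrue:
    "bval b s \<Longrightarrow> exec c1 s k s' \<Longrightarrow> exec (Cond b c1 c2) s (1 + bcost b + k) s'"
| exec_CondFalse:
    "\<not> bval b s \<Longrightarrow> exec c2 s k s' \<Longrightarrow> exec (Cond b c1 c2) s (1 + bcost b + k) s'"
| exec_WhileFalse:
    "\<not> bval b s \<Longrightarrow> exec (While b c) s (1 + bcost b) s"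
| exec_WhileTrue:
    "bval b s \<Longrightarrow> exec c s k1 s1 \<Longrightarrow> exec (While b c) s1 k2 s2
      \<Longrightarrow> exec (While b c) s (1 + bcost b + k1 + k2) s2"

inductive_cases exec_SkipE: "exec Skip s k s'"
inductive_cases exec_NWriteE: "exec (NWrite x i e) s k s'"
inductive_cases exec_RWriteE: "exec (RWrite x i e) s k s'"
inductive_cases exec_SeqE: "exec (Seq c1 c2) s k s'"
inductive_cases exec_CondE: "exec (Cond b c1 c2) s k s'"
inductive_cases exec_WhileE: "exec (While b c) s k s'"

lemma exec_deterministic:
  "exec c s k s' \<Longrightarrow> exec c s l s'' \<Longrightarrow> k = l \<and> s' = s''"
proof (induction arbitrary: l s'' rule: exec.induct)
  case (exec_Skip s)
  then show ?case by (rule exec_SkipE) simp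
next
  case (exec_NWrite x i e s)
  then show ?case by (rule exec_NWriteE) simp
next
  case (exec_RWrite x i e s)
  then show ?case by (rule exec_RWriteE) simp
next
  case (exec_Seq c1 s k1 s1 c2 k2 s2)
  from exec_Seq.prems show ?case
    by (rule exec_SeqE) (auto dest!: exec_Seq.IH)
next
  case (exec_CondTrue b s c1 k s' c2)
  from exec_CondTrue.prems show ?case
    by (rule exec_CondE) (auto dest!: exec_CondTrue.IH simp: exec_CondTrue.hyps)
next
  case (exec_CondFalse b s c2 k s' c1)
  from exec_CondFalse.prems show ?case
    by (rule exec_CondE) (auto dest!: exec_CondFalse.IH simp: exec_CondFalse.hyps)
next
  case (exec_WhileFalse b s c)
  from exec_WhileFalse.prems show ?case
    by (rule exec_WhileE) (auto simp: exec_WhileFalse.hyps)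
next
  case (exec_WhileTrue b s c k1 s1 k2 s2)
  from exec_WhileTrue.prems show ?case
    by (rule exec_WhileE) (auto dest!: exec_WhileTrue.IH simp: exec_WhileTrue.hyps)
qed

text \<open>The assortment is passed as its indicator vector.  The predicate leaves all memory cells
  that do not hold the input unconstrained.\<close>

definition holds_input :: "state \<Rightarrow> nat \<Rightarrow> nat \<Rightarrow> (nat \<Rightarrow> real) \<Rightarrow> nat set \<Rightarrow> bool" where
  "holds_input s T n v S \<longleftrightarrow>
     nat_mem s ''T'' 0 = T \<and>
     nat_mem s ''n'' 0 = n \<and>
     (\<forall>i\<in>{1..n}. real_mem s ''v'' i = v i) \<and>
     (\<forall>i\<in>{1..n}. nat_mem s ''S'' i = (if i \<in> S then 1 else 0))"

definition result :: "state \<Rightarrow> real" where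
  "result s = real_mem s ''out'' 0"

end

theory Submission
  imports Defs
begin

text \<open>The maximum load never exceeds the number \<open>T\<close> of customers, so
  \<open>E(M) = T - (\<Sum>m<T. P(M \<le> m))\<close>.  The event \<open>M \<le> m\<close> restricts the number of customers of each
  offered product separately, and counting words with bounded letter multiplicities by exponential
  generating functions gives
  \[ P(M \le m) = \frac{T!}{(1 + v(S))^T} \, [x^T] \; e^x \prod_{i \in S} \sum_{k \le m} \frac{(v_i x)^k}{k!} . \]
  The factor \<open>e^x\<close> is contributed by the customers who buy nothing, whose number is unrestricted.
  The combinatorial core is \<open>sum_bounded_profiles_insert\<close>: a new product is added by choosing which
  customers buy it.  Lemma \<open>expected_max_load_eq\<close> is the resulting formula for the expectation.

  For a fixed \<open>m\<close> the coefficients up to \<open>x^T\<close> are kept in one array, initialised with those of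
  \<open>e^x\<close> and multiplied by one truncated exponential series per offered product.  A multiplication
  is a convolution and takes \<open>O(T^2)\<close> operations, so one value of \<open>m\<close> takes \<open>O(n T^2)\<close> and all
  \<open>T\<close> values take \<open>O(n T^3)\<close> operations, which is even below the required \<open>O(n^2 T^3)\<close>.

  Correctness and running time of the program are proved together, with weakest preconditions
  whose postconditions also speak about the number of operations; \<open>wp_For\<close> multiplies the cost of a
  loop body by the number of iterations.\<close>

section \<open>The expected maximum load as a sum of generating function coefficients\<close>

text \<open>The coefficient of \<open>x^t\<close> in the product of a series with coefficients \<open>f\<close> and the truncated
  exponential series \<open>\<Sum>k\<le>m. (w x)^k / k!\<close>.\<close>

definition truncated_conv :: "nat \<Rightarrow> real \<Rightarrow> (nat \<Rightarrow> real) \<Rightarrow> nat \<Rightarrow> real" where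
  "truncated_conv m w f t = (\<Sum>k\<le>min t m. w ^ k / fact k * f (t - k))"

lemma truncated_conv_cong:
  "(\<And>u. u \<le> t \<Longrightarrow> f u = g u) \<Longrightarrow> truncated_conv m w f t = truncated_conv m w g t"
  unfolding truncated_conv_def by (intro sum.cong) auto

text \<open>The coefficients of \<open>e^x\<close> times the truncated exponential series of the offered products
  among \<open>1, \<dots>, i\<close>.\<close>

fun egf_coeff :: "nat \<Rightarrow> (nat \<Rightarrow> real) \<Rightarrow> nat set \<Rightarrow> nat \<Rightarrow> nat \<Rightarrow> real" where
  "egf_coeff m v S 0 = (\<lambda>t. 1 / fact t)"
| "egf_coeff m v S (Suc i) =
     (if Suc i \<in> S then truncated_conv m (v (Suc i)) (egf_coeff m v S i) else egf_coeff m v S i)"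

text \<open>The customers form an arbitrary finite set \<open>A\<close>, since the recursion over the products removes
  customers from it.  The value 0 outside \<open>A\<close> is the default value of the product distribution of
  choices; as it is also the no-purchase option, a customer who is removed is simply reassigned to 0.\<close>

definition bounded_profiles :: "nat \<Rightarrow> 'a set \<Rightarrow> nat set \<Rightarrow> ('a \<Rightarrow> nat) set" where
  "bounded_profiles m A S =
     {X \<in> PiE_dflt A 0 (\<lambda>_. insert 0 S). \<forall>i\<in>S. card {t\<in>A. X t = i} \<le> m}"

text \<open>The probability of a profile up to the common factor \<open>(1 + v(S))^card A\<close>.\<close>

definition profile_weight :: "(nat \<Rightarrow> real) \<Rightarrow> 'a set \<Rightarrow> ('a \<Rightarrow> nat) \<Rightarrow> real" where
  "profile_weight v A X = (\<Prod>t\<in>A. if X t = 0 then 1 else v (X t))"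

lemma finite_bounded_profiles: "finite A \<Longrightarrow> finite S \<Longrightarrow> finite (bounded_profiles m A S)"
  unfolding bounded_profiles_def by (rule finite_subset[of _ "PiE_dflt A 0 (\<lambda>_. insert 0 S)"]) auto

text \<open>A profile on \<open>insert i S\<close> is the same as the set \<open>B\<close> of customers who choose \<open>i\<close> together with
  a profile on \<open>S\<close> of the remaining customers.  The load of \<open>i\<close> is \<open>card B\<close>, and the loads of the
  other products are those of the remaining profile.\<close>

lemma sum_bounded_profiles_insert:
  assumes "finite A" "finite S" "i \<notin> S" "i \<noteq> 0"
  shows "(\<Sum>X\<in>bounded_profiles m A (insert i S). profile_weight v A X)
       = (\<Sum>B | B \<subseteq> A \<and> card B \<le> m.
            v i ^ card B * (\<Sum>Y\<in>bounded_profiles m (A - B) S. profile_weight v (A - B) Y))"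
proof -
  let ?P = "{B. B \<subseteq> A \<and> card B \<le> m}"
  have weight: "v i ^ card B * profile_weight v (A - B) Y
      = profile_weight v A (\<lambda>t. if t \<in> B then i else Y t)" if "B \<subseteq> A" for B Y
  proof -
    let ?X = "\<lambda>t. if t \<in> B then i else Y t"
    have "profile_weight v A ?X
        = (\<Prod>t\<in>A - B. if ?X t = 0 then 1 else v (?X t)) * (\<Prod>t\<in>B. if ?X t = 0 then 1 else v (?X t))"
      unfolding profile_weight_def using that assms by (intro prod.subset_diff) auto
    also have "(\<Prod>t\<in>A - B. if ?X t = 0 then 1 else v (?X t))
        = (\<Prod>t\<in>A - B. if Y t = 0 then 1 else v (Y t))"
      by (intro prod.cong) auto
    also have "(\<Prod>t\<in>B. if ?X t = 0 then 1 else v (?X t)) = (\<Prod>t\<in>B. v i)"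
      using assms by (intro prod.cong) auto
    finally show ?thesis by (simp add: profile_weight_def)
  qed
  have "(\<Sum>B\<in>?P. v i ^ card B * (\<Sum>Y\<in>bounded_profiles m (A - B) S. profile_weight v (A - B) Y))
      = (\<Sum>(B, Y)\<in>Sigma ?P (\<lambda>B. bounded_profiles m (A - B) S).
           v i ^ card B * profile_weight v (A - B) Y)"
    unfolding sum_distrib_left
    by (rule sum.Sigma) (use assms in \<open>auto intro!: finite_bounded_profiles\<close>)
  also have "\<dots> = (\<Sum>X\<in>bounded_profiles m A (insert i S). profile_weight v A X)"
  proof (rule sum.reindex_bij_witness
      [where j = "\<lambda>(B, Y) t. if t \<in> B then i else Y t"
         and i = "\<lambda>X. ({t\<in>A. X t = i}, \<lambda>t. if X t = i then 0 else X t)"])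
    fix p assume "p \<in> Sigma ?P (\<lambda>B. bounded_profiles m (A - B) S)"
    then obtain B Y where p: "p = (B, Y)" and B: "B \<subseteq> A" "card B \<le> m"
      and Y: "Y \<in> bounded_profiles m (A - B) S" by auto
    let ?X = "\<lambda>t. if t \<in> B then i else Y t"
    have Y0: "Y t = 0" if "t \<notin> A - B" for t
      using Y that unfolding bounded_profiles_def PiE_dflt_def by auto
    have YS: "Y t \<in> insert 0 S" for t
      using Y Y0[of t] unfolding bounded_profiles_def PiE_dflt_def by auto
    have Yi: "Y t \<noteq> i" for t using YS[of t] assms by auto
    have Xi: "{t\<in>A. ?X t = i} = B" using B Yi by auto
    have XS: "{t\<in>A. ?X t = l} = {t\<in>A - B. Y t = l}" if "l \<in> S" for l
      using that assms by auto
    have "?X \<in> PiE_dflt A 0 (\<lambda>_. insert 0 (insert i S))"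
      unfolding PiE_dflt_def using YS Y0 B(1) by simp blast
    then show "(case p of (B, Y) \<Rightarrow> \<lambda>t. if t \<in> B then i else Y t) \<in> bounded_profiles m A (insert i S)"
      using B Y Xi XS p unfolding bounded_profiles_def by auto
    show "({t\<in>A. (case p of (B, Y) \<Rightarrow> \<lambda>t. if t \<in> B then i else Y t) t = i},
       \<lambda>t. if (case p of (B, Y) \<Rightarrow> \<lambda>t. if t \<in> B then i else Y t) t = i then 0
           else (case p of (B, Y) \<Rightarrow> \<lambda>t. if t \<in> B then i else Y t) t) = p"
      using Xi Yi Y0 by (auto simp: p fun_eq_iff)
    show "profile_weight v A (case p of (B, Y) \<Rightarrow> \<lambda>t. if t \<in> B then i else Y t)
        = (case p of (B, Y) \<Rightarrow> v i ^ card B * profile_weight v (A - B) Y)"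
      using weight[OF B(1)] by (simp add: p)
  next
    fix X assume X: "X \<in> bounded_profiles m A (insert i S)"
    let ?B = "{t\<in>A. X t = i}" and ?Y = "\<lambda>t. if X t = i then 0 else X t"
    have X0: "X t = 0" if "t \<notin> A" for t
      using X that unfolding bounded_profiles_def PiE_dflt_def by auto
    have "{t\<in>A - ?B. ?Y t = l} = {t\<in>A. X t = l}" if "l \<in> S" "l \<noteq> 0" for l
      using that assms by auto
    moreover have "{t\<in>A - ?B. ?Y t = 0} = {t\<in>A. X t = 0}"
      using assms by auto
    ultimately have "card {t\<in>A - ?B. ?Y t = l} \<le> m" if "l \<in> S" for l
      using that X by (cases "l = 0") (auto simp: bounded_profiles_def)
    then have "?Y \<in> bounded_profiles m (A - ?B) S"
      using X unfolding bounded_profiles_def PiE_dflt_def by auto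
    then show "(?B, ?Y) \<in> Sigma ?P (\<lambda>B. bounded_profiles m (A - B) S)"
      using X unfolding bounded_profiles_def by auto
    show "(case (?B, ?Y) of (B, Y) \<Rightarrow> \<lambda>t. if t \<in> B then i else Y t) = X"
    proof (rule ext)
      fix t
      show "(case (?B, ?Y) of (B, Y) \<Rightarrow> \<lambda>t. if t \<in> B then i else Y t) t = X t"
        using X0[of t] assms(4) by (cases "X t = i") auto
    qed
  qed
  finally show ?thesis ..
qed

lemma sum_subsets_card_le:
  fixes g :: "nat \<Rightarrow> real"
  assumes "finite A"
  shows "(\<Sum>B | B \<subseteq> A \<and> card B \<le> m. g (card B))
       = (\<Sum>k\<le>min (card A) m. real (card A choose k) * g k)"
proof -
  let ?P = "{B. B \<subseteq> A \<and> card B \<le> m}"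
  have "(\<Sum>B\<in>?P. g (card B)) = (\<Sum>k\<le>min (card A) m. \<Sum>B | B \<in> ?P \<and> card B = k. g (card B))"
    using assms by (intro sum.group[symmetric]) (auto intro: card_mono)
  also have "\<dots> = (\<Sum>k\<le>min (card A) m. real (card A choose k) * g k)"
  proof (rule sum.cong)
    fix k assume "k \<in> {..min (card A) m}"
    then have "{B. B \<in> ?P \<and> card B = k} = {B. B \<subseteq> A \<and> card B = k}" by auto
    then show "(\<Sum>B | B \<in> ?P \<and> card B = k. g (card B)) = real (card A choose k) * g k"
      using n_subsets[OF assms, of k] by simp
  qed simp
  finally show ?thesis .
qed

text \<open>There are \<open>a choose k\<close> sets of \<open>k\<close> among \<open>a\<close> customers, and
  \<open>(a choose k) * (a - k)! = a! / k!\<close>; dividing the weighted count by \<open>a!\<close> thus turns the recursion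
  over the products into a convolution with \<open>v i ^ k / k!\<close>.\<close>

lemma sum_bounded_profiles_eq_egf_coeff:
  assumes "finite A"
  shows "(\<Sum>X\<in>bounded_profiles m A (S \<inter> {1..i}). profile_weight v A X)
       = fact (card A) * egf_coeff m v S i (card A)"
  using assms
proof (induction i arbitrary: A)
  case 0
  have "bounded_profiles m A {} = {\<lambda>_. 0}"
    by (auto simp: bounded_profiles_def PiE_dflt_def fun_eq_iff)
  then show ?case by (simp add: profile_weight_def)
next
  case (Suc i)
  let ?a = "card A"
  let ?c = "egf_coeff m v S i"
  show ?case
  proof (cases "Suc i \<in> S")
    case False
    then have "S \<inter> {1..Suc i} = S \<inter> {1..i}" by (auto simp: le_Suc_eq)
    with False Suc show ?thesis by simp
  next
    case True
    then have "S \<inter> {1..Suc i} = insert (Suc i) (S \<inter> {1..i})" by (auto simp: le_Suc_eq)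
    then have "(\<Sum>X\<in>bounded_profiles m A (S \<inter> {1..Suc i}). profile_weight v A X)
       = (\<Sum>B | B \<subseteq> A \<and> card B \<le> m. v (Suc i) ^ card B *
            (\<Sum>Y\<in>bounded_profiles m (A - B) (S \<inter> {1..i}). profile_weight v (A - B) Y))"
      using Suc.prems by (simp add: sum_bounded_profiles_insert)
    also have "\<dots> = (\<Sum>B | B \<subseteq> A \<and> card B \<le> m.
        v (Suc i) ^ card B * (fact (?a - card B) * ?c (?a - card B)))"
    proof (rule sum.cong)
      fix B assume "B \<in> {B. B \<subseteq> A \<and> card B \<le> m}"
      then have "card (A - B) = ?a - card B"
        using Suc.prems by (intro card_Diff_subset) (auto intro: finite_subset)
      then show "v (Suc i) ^ card B *
            (\<Sum>Y\<in>bounded_profiles m (A - B) (S \<inter> {1..i}). profile_weight v (A - B) Y)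
          = v (Suc i) ^ card B * (fact (?a - card B) * ?c (?a - card B))"
        using Suc.IH[of "A - B"] Suc.prems by simp
    qed simp
    also have "\<dots> = (\<Sum>k\<le>min ?a m. real (?a choose k) *
        (v (Suc i) ^ k * (fact (?a - k) * ?c (?a - k))))"
      using Suc.prems by (rule sum_subsets_card_le)
    also have "\<dots> = fact ?a * truncated_conv m (v (Suc i)) ?c ?a"
      unfolding truncated_conv_def sum_distrib_left
      by (rule sum.cong) (auto simp: binomial_fact)
    finally show ?thesis using True by simp
  qed
qed

lemma max_load_le_iff:
  "finite S \<Longrightarrow> max_load T S X \<le> m \<longleftrightarrow> (\<forall>i\<in>S. load T X i \<le> m)"
  by (auto simp: max_load_def)

lemma load_le: "load T X i \<le> T"
  unfolding load_def by (rule order_trans[OF card_mono[of "{1..T}"]]) auto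

text \<open>The tail formula \<open>M = T - card {m. m < T \<and> M \<le> m}\<close>, averaged over the finitely many profiles that
  have positive probability.\<close>

lemma expected_max_load_eq:
  assumes S: "S \<subseteq> {1..n}" and v: "\<forall>i\<in>{1..n}. 0 < v i"
  shows "expected_max_load T v S
       = real T - (\<Sum>m<T. fact T / (1 + weight v S) ^ T * egf_coeff m v S n T)"
proof -
  let ?\<Omega> = "PiE_dflt {1..T} 0 (\<lambda>_. insert 0 S)"
  let ?W = "1 + weight v S"
  have fin: "finite S" using S finite_subset by auto
  have fin\<Omega>: "finite ?\<Omega>" using fin by auto
  have pmf: "pmf (choices_pmf T v S) X = profile_weight v {1..T} X / ?W ^ T" if "X \<in> ?\<Omega>" for X
  proof -
    have "pmf (choices_pmf T v S) X = (\<Prod>t\<in>{1..T}. choice_prob v S (X t))"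
      using that unfolding choices_pmf_def
      by (subst pmf_Pi') (auto simp: PiE_dflt_def pmf_choice_pmf[OF S v])
    also have "\<dots> = (\<Prod>t\<in>{1..T}. (if X t = 0 then 1 else v (X t)) / ?W)"
      using that by (intro prod.cong) (auto simp: PiE_dflt_def choice_prob_def)
    finally show ?thesis by (simp add: prod_dividef profile_weight_def)
  qed
  have supp: "X \<in> ?\<Omega>" if "X \<in> set_pmf (choices_pmf T v S)" for X
  proof -
    have "choice_prob v S (X t) \<noteq> 0" if "t \<in> {1..T}" for t
      using \<open>X \<in> _\<close> that set_Pi_pmf_subset'[of "{1..T}" 0 "\<lambda>_. choice_pmf v S"]
      by (auto simp: choices_pmf_def PiE_dflt_def set_pmf_iff pmf_choice_pmf[OF S v])
    moreover have "X t = 0" if "t \<notin> {1..T}" for t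
      using \<open>X \<in> _\<close> that set_Pi_pmf_subset'[of "{1..T}" 0 "\<lambda>_. choice_pmf v S"]
      by (auto simp: choices_pmf_def PiE_dflt_def)
    ultimately show ?thesis
      by (fastforce simp: PiE_dflt_def choice_prob_def split: if_splits)
  qed
  have total: "(\<Sum>X\<in>?\<Omega>. pmf (choices_pmf T v S) X) = 1"
    using fin\<Omega> supp by (intro sum_pmf_eq_1) auto
  have prob: "(\<Sum>X\<in>?\<Omega>. if max_load T S X \<le> m then pmf (choices_pmf T v S) X else 0)
      = fact T / ?W ^ T * egf_coeff m v S n T" for m
  proof -
    have bp: "{X \<in> ?\<Omega>. max_load T S X \<le> m} = bounded_profiles m {1..T} (S \<inter> {1..n})"
      using S by (auto simp: bounded_profiles_def max_load_le_iff[OF fin] load_def Int_absorb2)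
    have "(\<Sum>X\<in>?\<Omega>. if max_load T S X \<le> m then pmf (choices_pmf T v S) X else 0)
        = (\<Sum>X | X \<in> ?\<Omega> \<and> max_load T S X \<le> m. pmf (choices_pmf T v S) X)"
      using fin\<Omega> by (simp add: sum.inter_filter)
    also have "\<dots> = (\<Sum>X | X \<in> ?\<Omega> \<and> max_load T S X \<le> m. profile_weight v {1..T} X / ?W ^ T)"
      by (intro sum.cong) (auto simp: pmf)
    also have "\<dots> = fact T * egf_coeff m v S n T / ?W ^ T"
      using sum_bounded_profiles_eq_egf_coeff[of "{1..T}" v m S n]
      unfolding bp by (simp add: sum_divide_distrib[symmetric])
    finally show ?thesis by simp
  qed
  have tail: "real (max_load T S X) = real T - (\<Sum>m<T. if max_load T S X \<le> m then 1 else 0)" for X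
  proof -
    have le: "max_load T S X \<le> T" using load_le by (simp add: max_load_le_iff[OF fin])
    have "{m. m < T \<and> max_load T S X \<le> m} = {max_load T S X..<T}" by auto
    then have "(\<Sum>m<T. if max_load T S X \<le> m then 1 else 0) = real (T - max_load T S X)"
      by (simp add: sum.inter_filter[symmetric])
    with le show ?thesis by simp
  qed
  have "expected_max_load T v S = (\<Sum>X\<in>?\<Omega>. real (max_load T S X) * pmf (choices_pmf T v S) X)"
    unfolding expected_max_load_def by (rule integral_measure_pmf_real) (use fin\<Omega> supp in auto)
  also have "\<dots> = (\<Sum>X\<in>?\<Omega>. real T * pmf (choices_pmf T v S) X
      - (\<Sum>m<T. if max_load T S X \<le> m then pmf (choices_pmf T v S) X else 0))"
    by (auto simp: tail left_diff_distrib sum_distrib_right intro!: sum.cong)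
  also have "\<dots> = real T - (\<Sum>m<T. \<Sum>X\<in>?\<Omega>. if max_load T S X \<le> m then pmf (choices_pmf T v S) X else 0)"
    by (subst sum.swap) (simp add: sum_subtractf sum_distrib_left[symmetric] total del: One_nat_def)
  finally show ?thesis unfolding prob .
qed

section \<open>Weakest preconditions with running time\<close>

text \<open>Total correctness: the postcondition receives the number of operations and the final state.
  As programs are deterministic, some halting run is the only one.\<close>

definition wp :: "com \<Rightarrow> state \<Rightarrow> (nat \<Rightarrow> state \<Rightarrow> bool) \<Rightarrow> bool" where
  "wp c s Q \<longleftrightarrow> (\<exists>k s'. exec c s k s' \<and> Q k s')"

lemma wp_mono: "wp c s P \<Longrightarrow> (\<And>k s'. P k s' \<Longrightarrow> Q k s') \<Longrightarrow> wp c s Q"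
  unfolding wp_def by blast

lemma wp_Skip [simp]: "wp Skip s Q \<longleftrightarrow> Q 1 s"
  unfolding wp_def
  by (rule iffI, (elim exE conjE exec_SkipE, simp), (intro exI conjI, rule exec_Skip, assumption))

lemma wp_NWrite [simp]:
  "wp (NWrite x i e) s Q \<longleftrightarrow> Q (1 + ncost i + ncost e) (nat_write x (nval i s) (nval e s) s)"
  unfolding wp_def
  by (rule iffI, (elim exE conjE exec_NWriteE, simp), (intro exI conjI, rule exec_NWrite, assumption))

lemma wp_RWrite [simp]:
  "wp (RWrite x i e) s Q \<longleftrightarrow> Q (1 + ncost i + rcost e) (real_write x (nval i s) (rval e s) s)"
  unfolding wp_def
  by (rule iffI, (elim exE conjE exec_RWriteE, simp), (intro exI conjI, rule exec_RWrite, assumption))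

lemma wp_Seq [simp]:
  "wp (Seq c1 c2) s Q \<longleftrightarrow> wp c1 s (\<lambda>k1 s1. wp c2 s1 (\<lambda>k2 s2. Q (1 + k1 + k2) s2))"
proof
  assume "wp (Seq c1 c2) s Q"
  then obtain k s' where "exec (Seq c1 c2) s k s'" "Q k s'"
    unfolding wp_def by blast
  then show "wp c1 s (\<lambda>k1 s1. wp c2 s1 (\<lambda>k2 s2. Q (1 + k1 + k2) s2))"
    unfolding wp_def by (elim exec_SeqE) fastforce
next
  assume "wp c1 s (\<lambda>k1 s1. wp c2 s1 (\<lambda>k2 s2. Q (1 + k1 + k2) s2))"
  then obtain k1 s1 k2 s2 where "exec c1 s k1 s1" "exec c2 s1 k2 s2" "Q (1 + k1 + k2) s2"
    unfolding wp_def by blast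
  then show "wp (Seq c1 c2) s Q"
    unfolding wp_def using exec_Seq by blast
qed

lemma wp_Cond [simp]:
  "wp (Cond b c1 c2) s Q \<longleftrightarrow> wp (if bval b s then c1 else c2) s (\<lambda>k. Q (1 + bcost b + k))"
proof
  assume "wp (Cond b c1 c2) s Q"
  then obtain k s' where "exec (Cond b c1 c2) s k s'" "Q k s'"
    unfolding wp_def by blast
  then show "wp (if bval b s then c1 else c2) s (\<lambda>k. Q (1 + bcost b + k))"
    unfolding wp_def by (elim exec_CondE) auto
next
  assume "wp (if bval b s then c1 else c2) s (\<lambda>k. Q (1 + bcost b + k))"
  then obtain k s' where "exec (if bval b s then c1 else c2) s k s'" "Q (1 + bcost b + k) s'"
    unfolding wp_def by blast
  then show "wp (Cond b c1 c2) s Q"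
    unfolding wp_def by (cases "bval b s") (use exec_CondTrue exec_CondFalse in fastforce)+
qed

lemma wp_While_False: "\<not> bval b s \<Longrightarrow> Q (1 + bcost b) s \<Longrightarrow> wp (While b c) s Q"
  unfolding wp_def by (blast intro: exec_WhileFalse)

lemma wp_While_True:
  "bval b s \<Longrightarrow> wp c s (\<lambda>k1 s1. wp (While b c) s1 (\<lambda>k2. Q (1 + bcost b + k1 + k2)))
    \<Longrightarrow> wp (While b c) s Q"
  unfolding wp_def by (blast intro: exec_WhileTrue)

abbreviation nvar :: "string \<Rightarrow> nexp" where "nvar x \<equiv> NRead x (NConst 0)"
abbreviation rvar :: "string \<Rightarrow> rexp" where "rvar x \<equiv> RRead x (NConst 0)"
abbreviation nset :: "string \<Rightarrow> nexp \<Rightarrow> com" where "nset x e \<equiv> NWrite x (NConst 0) e"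
abbreviation rset :: "string \<Rightarrow> rexp \<Rightarrow> com" where "rset x e \<equiv> RWrite x (NConst 0) e"
abbreviation succ_var :: "string \<Rightarrow> nexp" where "succ_var x \<equiv> NAdd (nvar x) (NConst 1)"

lemma nat_mem_nat_write [simp]:
  "nat_mem (nat_write x i k s) y = (if y = x then (nat_mem s x)(i := k) else nat_mem s y)"
  by (simp add: nat_write_def)

lemma real_mem_nat_write [simp]: "real_mem (nat_write x i k s) = real_mem s"
  by (simp add: nat_write_def)

lemma real_mem_real_write [simp]:
  "real_mem (real_write x i r s) y = (if y = x then (real_mem s x)(i := r) else real_mem s y)"
  by (simp add: real_write_def)

lemma nat_mem_real_write [simp]: "nat_mem (real_write x i r s) = nat_mem s"
  by (simp add: real_write_def)

text \<open>The bound \<open>e\<close> is evaluated again before each iteration, so its cost is charged each time.\<close>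

definition For :: "string \<Rightarrow> nexp \<Rightarrow> com \<Rightarrow> com" where
  "For x e c = Seq (nset x (NConst 0))
     (While (NLess (nvar x) e) (Seq c (nset x (succ_var x))))"

text \<open>With at most \<open>m\<close> iterations of a body of cost at most \<open>b * q\<close>, the cost of the loop is again a
  constant times a product of sizes, the form that the enclosing loop needs.  Besides the body, an
  iteration costs \<open>11 + ncost e\<close> for test, increment and sequencing; \<open>8 + ncost e\<close> are spent once, on the
  initialisation and the last test.  Since \<open>1 \<le> m * q\<close>, both are absorbed into the factor.\<close>

lemma wp_For:
  assumes start: "I 0 (nat_write x 0 0 s)"
    and bound: "\<And>j s. I j s \<Longrightarrow> nval e s = N"
    and step: "\<And>j s. j < N \<Longrightarrow> I j s \<Longrightarrow> nat_mem s x 0 = j \<Longrightarrow>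
      wp c s (\<lambda>k s'. k \<le> b * q \<and> nat_mem s' x 0 = j \<and> I (Suc j) (nat_write x 0 (Suc j) s'))"
    and sizes: "N \<le> m" "1 \<le> m" "1 \<le> q"
  shows "wp (For x e c) s (\<lambda>k s'. k \<le> (19 + 2 * ncost e + b) * (m * q) \<and> I N s')"
proof -
  let ?loop = "While (NLess (nvar x) e) (Seq c (nset x (succ_var x)))"
  let ?d = "11 + ncost e + b * q"
  have loop: "wp ?loop t (\<lambda>k s'. k \<le> 4 + ncost e + r * ?d \<and> I N s')"
    if "I j t" "nat_mem t x 0 = j" "j + r = N" for j t r
    using that
  proof (induction r arbitrary: j t)
    case 0
    then show ?case by (intro wp_While_False) (auto simp: bound)
  next
    case (Suc r)
    have "bval (NLess (nvar x) e) t" using Suc.prems bound by simp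
    moreover have "wp c t (\<lambda>k s'. k \<le> b * q \<and> nat_mem s' x 0 = j \<and> I (Suc j) (nat_write x 0 (Suc j) s'))"
      using Suc.prems by (intro step) auto
    then have "wp c t (\<lambda>k s'. k \<le> b * q \<and> nat_mem s' x 0 = j \<and>
        wp ?loop (nat_write x 0 (Suc j) s') (\<lambda>k s'. k \<le> 4 + ncost e + r * ?d \<and> I N s'))"
    proof (rule wp_mono)
      fix k s'
      assume *: "k \<le> b * q \<and> nat_mem s' x 0 = j \<and> I (Suc j) (nat_write x 0 (Suc j) s')"
      then have "wp ?loop (nat_write x 0 (Suc j) s') (\<lambda>k s'. k \<le> 4 + ncost e + r * ?d \<and> I N s')"
        using Suc.prems by (intro Suc.IH[of "Suc j"]) auto
      with * show "k \<le> b * q \<and> nat_mem s' x 0 = j \<and>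
        wp ?loop (nat_write x 0 (Suc j) s') (\<lambda>k s'. k \<le> 4 + ncost e + r * ?d \<and> I N s')"
        by blast
    qed
    then have "wp (Seq c (nset x (succ_var x))) t (\<lambda>k s'. k \<le> 7 + b * q \<and>
        wp ?loop s' (\<lambda>k s'. k \<le> 4 + ncost e + r * ?d \<and> I N s'))"
      unfolding wp_Seq by (rule wp_mono) simp
    then have "wp (Seq c (nset x (succ_var x))) t (\<lambda>k1 s1.
        wp ?loop s1 (\<lambda>k2 s2. 1 + bcost (NLess (nvar x) e) + k1 + k2 \<le> 4 + ncost e + Suc r * ?d \<and> I N s2))"
      by (rule wp_mono) (elim conjE, erule wp_mono, simp)
    ultimately show ?case by (rule wp_While_True)
  qed
  have "4 + (4 + ncost e + N * ?d) \<le> 8 + ncost e + m * ?d"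
    using sizes mult_le_mono1[of N m ?d] by linarith
  also have "\<dots> \<le> (8 + ncost e) * (m * q) + ((11 + ncost e) * (m * q) + b * (m * q))"
  proof -
    have "1 * 1 \<le> m * q" by (rule mult_le_mono) (use sizes in auto)
    then have "(8 + ncost e) * 1 \<le> (8 + ncost e) * (m * q)" by (intro mult_le_mono2) simp
    moreover have "m * (11 + ncost e) * 1 \<le> m * (11 + ncost e) * q"
      using sizes by (intro mult_le_mono2)
    ultimately show ?thesis by (simp add: algebra_simps)
  qed
  finally have cost: "4 + (4 + ncost e + N * ?d) \<le> (19 + 2 * ncost e + b) * (m * q)"
    by (simp add: algebra_simps)
  have "wp ?loop (nat_write x 0 0 s) (\<lambda>k s'. k \<le> 4 + ncost e + N * ?d \<and> I N s')"
    by (rule loop[of 0]) (use start in auto)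
  then have "wp ?loop (nat_write x 0 0 s) (\<lambda>k s'. 4 + k \<le> (19 + 2 * ncost e + b) * (m * q) \<and> I N s')"
    by (rule wp_mono) (use cost in linarith)
  then show ?thesis by (auto simp: For_def elim!: wp_mono)
qed

definition unchanged :: "string set \<Rightarrow> string set \<Rightarrow> state \<Rightarrow> state \<Rightarrow> bool" where
  "unchanged NS RS s s' \<longleftrightarrow>
     (\<forall>x. x \<notin> NS \<longrightarrow> nat_mem s' x = nat_mem s x) \<and>
     (\<forall>x. x \<notin> RS \<longrightarrow> real_mem s' x = real_mem s x)"

section \<open>The program and its running time\<close>

text \<open>Arrays used by the programs: \<open>f\<close> holds the coefficients, \<open>acc\<close> and \<open>pow\<close> the partial sum
  and the current factor \<open>w^k / k!\<close> of a convolution, \<open>W\<close> the total weight \<open>1 + v(S)\<close>, and \<open>Z\<close> the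
  factor \<open>T! / (1 + v(S))^T\<close>.  The numerals in the cost bounds are generous.\<close>

text \<open>The position \<open>T - j\<close> runs downwards from \<open>T\<close>, because the counter \<open>j\<close> of the loop
  around it runs upwards.\<close>

abbreviation pos_exp :: nexp where "pos_exp \<equiv> NSub (nvar ''T'') (nvar ''j'')"

text \<open>One coefficient of the product.  The bound of the loop is \<open>min (T - j) m + 1\<close>, written with
  truncated subtraction as \<open>(T - j + 1) - ((T - j) - m)\<close>.\<close>

definition conv_entry :: com where
  "conv_entry =
     Seq (rset ''acc'' (ROfNat (NConst 0)))
    (Seq (rset ''pow'' (ROfNat (NConst 1)))
    (Seq (For ''k'' (NSub (NAdd pos_exp (NConst 1)) (NSub pos_exp (nvar ''m'')))
           (Seq (rset ''acc'' (RAdd (rvar ''acc'')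
                   (RMul (rvar ''pow'') (RRead ''f'' (NSub pos_exp (nvar ''k''))))))
                (rset ''pow'' (RDiv (RMul (rvar ''pow'') (RRead ''v'' (succ_var ''i'')))
                   (ROfNat (succ_var ''k''))))))
         (RWrite ''f'' pos_exp (rvar ''acc''))))"

lemma conv_entry:
  assumes "nat_mem s ''T'' 0 = T" "nat_mem s ''j'' 0 = j" "nat_mem s ''m'' 0 = m"
    and "real_mem s ''v'' (Suc (nat_mem s ''i'' 0)) = w" "real_mem s ''f'' = f"
    and "m < T"
  shows "wp conv_entry s (\<lambda>k s'. k \<le> 200 * T \<and> unchanged {''k''} {''acc'', ''pow'', ''f''} s s' \<and>
    real_mem s' ''f'' = f(T - j := truncated_conv m w f (T - j)))"
proof -
  let ?s1 = "real_write ''pow'' 0 1 (real_write ''acc'' 0 0 s)"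
  let ?N = "Suc (min (T - j) m)"
  let ?I = "\<lambda>k s'. unchanged {''k''} {''acc'', ''pow''} s s' \<and>
     real_mem s' ''acc'' 0 = (\<Sum>l<k. w ^ l / fact l * f (T - j - l)) \<and>
     real_mem s' ''pow'' 0 = w ^ k / fact k"
  let ?body = "Seq (rset ''acc'' (RAdd (rvar ''acc'')
                   (RMul (rvar ''pow'') (RRead ''f'' (NSub pos_exp (nvar ''k''))))))
                (rset ''pow'' (RDiv (RMul (rvar ''pow'') (RRead ''v'' (succ_var ''i'')))
                   (ROfNat (succ_var ''k''))))"
  let ?e = "NSub (NAdd pos_exp (NConst 1)) (NSub pos_exp (nvar ''m''))"
  have "wp (For ''k'' ?e ?body) ?s1
    (\<lambda>k s'. k \<le> (19 + 2 * ncost ?e + 40) * (T * 1) \<and> ?I ?N s')"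
  proof (rule wp_For)
    show "?I 0 (nat_write ''k'' 0 0 ?s1)" by (simp add: unchanged_def)
    show "nval ?e s' = ?N" if "?I k s'" for k s'
      using that assms by (simp add: unchanged_def min_def)
    show "wp ?body s' (\<lambda>c s''. c \<le> 40 * 1 \<and> nat_mem s'' ''k'' 0 = k \<and>
        ?I (Suc k) (nat_write ''k'' 0 (Suc k) s''))"
      if "k < ?N" "?I k s'" "nat_mem s' ''k'' 0 = k" for k s'
      using that assms by (simp add: unchanged_def) (simp add: field_simps)
    show "?N \<le> T" "1 \<le> T" using assms by auto
  qed simp
  then show ?thesis
    unfolding conv_entry_def using assms
    by (auto simp: unchanged_def truncated_conv_def lessThan_Suc_atMost fun_eq_iff elim!: wp_mono)
qed

text \<open>Coefficient \<open>t\<close> of a product depends on the coefficients up to \<open>t\<close> of the factor only.  The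
  row can therefore be overwritten in place, from position \<open>T\<close> down to position 0.\<close>

definition conv_row :: com where
  "conv_row = For ''j'' (succ_var ''T'') conv_entry"

lemma conv_row:
  assumes "nat_mem s ''T'' 0 = T" "nat_mem s ''m'' 0 = m" "m < T"
    and "real_mem s ''v'' (Suc (nat_mem s ''i'' 0)) = w"
    and f: "\<And>t. t \<le> T \<Longrightarrow> real_mem s ''f'' t = f t"
  shows "wp conv_row s (\<lambda>k s'. k \<le> 454 * (T * T) \<and>
    unchanged {''j'', ''k''} {''acc'', ''pow'', ''f''} s s' \<and>
    (\<forall>t\<le>T. real_mem s' ''f'' t = truncated_conv m w f t))"
proof -
  \<comment> \<open>After \<open>j\<close> steps exactly the positions above \<open>T - j\<close> are new; \<open>T < t + j\<close> says this also
    for \<open>j = T + 1\<close>, where position 0 is new, too.\<close>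
  let ?I = "\<lambda>j s'. unchanged {''j'', ''k''} {''acc'', ''pow'', ''f''} s s' \<and>
    (\<forall>t\<le>T. real_mem s' ''f'' t = (if T < t + j then truncated_conv m w f t else f t))"
  have "wp conv_row s
    (\<lambda>k s'. k \<le> (19 + 2 * ncost (succ_var ''T'') + 200) * (2 * T * T) \<and> ?I (Suc T) s')"
    unfolding conv_row_def
  proof (rule wp_For[where I = "?I" and N = "Suc T"])
    show "?I 0 (nat_write ''j'' 0 0 s)" using f by (simp add: unchanged_def)
    show "nval (succ_var ''T'') s' = Suc T" if "?I j s'" for j s'
      using that assms by (simp add: unchanged_def)
    show "wp conv_entry s' (\<lambda>k s''. k \<le> 200 * T \<and> nat_mem s'' ''j'' 0 = j \<and>
        ?I (Suc j) (nat_write ''j'' 0 (Suc j) s''))"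
      if "j < Suc T" and I: "?I j s'" and j: "nat_mem s' ''j'' 0 = j" for j s'
    proof -
      let ?g = "real_mem s' ''f''"
      have conv: "truncated_conv m w ?g (T - j) = truncated_conv m w f (T - j)"
        using I that(1) by (intro truncated_conv_cong) auto
      have "wp conv_entry s' (\<lambda>k s''. k \<le> 200 * T \<and>
          unchanged {''k''} {''acc'', ''pow'', ''f''} s' s'' \<and>
          real_mem s'' ''f'' = ?g(T - j := truncated_conv m w ?g (T - j)))"
        by (rule conv_entry) (use I j assms in \<open>auto simp: unchanged_def\<close>)
      then show ?thesis
      proof (rule wp_mono, intro conjI)
        fix k s''
        assume post: "k \<le> 200 * T \<and> unchanged {''k''} {''acc'', ''pow'', ''f''} s' s'' \<and>
          real_mem s'' ''f'' = ?g(T - j := truncated_conv m w ?g (T - j))"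
        then show "k \<le> 200 * T" ..
        show "nat_mem s'' ''j'' 0 = j"
          using post j by (simp add: unchanged_def)
        show "unchanged {''j'', ''k''} {''acc'', ''pow'', ''f''} s (nat_write ''j'' 0 (Suc j) s'')"
          using post I by (simp add: unchanged_def)
        show "\<forall>t\<le>T. real_mem (nat_write ''j'' 0 (Suc j) s'') ''f'' t
            = (if T < t + Suc j then truncated_conv m w f t else f t)"
        proof (intro allI impI)
          fix t assume "t \<le> T"
          have "t = T - j \<or> (T < t + Suc j \<longleftrightarrow> T < t + j)" by linarith
          then show "real_mem (nat_write ''j'' 0 (Suc j) s'') ''f'' t
            = (if T < t + Suc j then truncated_conv m w f t else f t)"
            using post I \<open>t \<le> T\<close> that(1) conv by auto
        qed
      qed
    qed
    \<comment> \<open>The loop runs \<open>T + 1\<close> times, at most \<open>2 * T\<close> because \<open>1 \<le> T\<close>.\<close>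
    show "Suc T \<le> 2 * T" "1 \<le> 2 * T" "1 \<le> T" using assms by auto
  qed
  then show ?thesis by (rule wp_mono) auto
qed

lemma holds_input_unchanged:
  assumes "holds_input s T n v S" "unchanged NS RS s s'"
    and "''T'' \<notin> NS" "''n'' \<notin> NS" "''S'' \<notin> NS" "''v'' \<notin> RS"
  shows "holds_input s' T n v S"
  using assms unfolding holds_input_def unchanged_def by metis

definition init_row :: com where
  "init_row =
     Seq (RWrite ''f'' (NConst 0) (ROfNat (NConst 1)))
         (For ''j'' (nvar ''T'')
           (RWrite ''f'' (succ_var ''j'') (RDiv (RRead ''f'' (nvar ''j'')) (ROfNat (succ_var ''j'')))))"

lemma init_row:
  assumes "nat_mem s ''T'' 0 = T" "1 \<le> T"
  shows "wp init_row s (\<lambda>k s'. k \<le> 60 * T \<and> unchanged {''j''} {''f''} s s' \<and>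
    (\<forall>t\<le>T. real_mem s' ''f'' t = 1 / fact t))"
proof -
  let ?s1 = "real_write ''f'' 0 1 s"
  let ?body = "RWrite ''f'' (succ_var ''j'') (RDiv (RRead ''f'' (nvar ''j'')) (ROfNat (succ_var ''j'')))"
  let ?I = "\<lambda>j s'. unchanged {''j''} {''f''} s s' \<and> (\<forall>t\<le>j. real_mem s' ''f'' t = 1 / fact t)"
  have "wp (For ''j'' (nvar ''T'') ?body) ?s1
    (\<lambda>k s'. k \<le> (19 + 2 * ncost (nvar ''T'') + 20) * (T * 1) \<and> ?I T s')"
  proof (rule wp_For[where I = "?I" and N = T])
    show "?I 0 (nat_write ''j'' 0 0 ?s1)" by (simp add: unchanged_def)
    show "nval (nvar ''T'') s' = T" if "?I j s'" for j s'
      using that assms by (simp add: unchanged_def)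
    show "wp ?body s' (\<lambda>k s''. k \<le> 20 * 1 \<and> nat_mem s'' ''j'' 0 = j \<and>
        ?I (Suc j) (nat_write ''j'' 0 (Suc j) s''))"
      if "j < T" "?I j s'" "nat_mem s' ''j'' 0 = j" for j s'
      using that by (auto simp: unchanged_def le_Suc_eq mult.commute)
    show "T \<le> T" "1 \<le> T" "(1::nat) \<le> 1" using assms by auto
  qed
  then show ?thesis
    unfolding init_row_def using assms by (auto simp: unchanged_def elim!: wp_mono)
qed

abbreviation offered :: bexp where
  "offered \<equiv> NLess (NConst 0) (NRead ''S'' (succ_var ''i''))"

definition egf_coeff_prog :: com where
  "egf_coeff_prog = Seq init_row (For ''i'' (nvar ''n'') (Cond offered conv_row Skip))"

lemma egf_coeff_prog:
  assumes input: "holds_input s T n v S" and m: "nat_mem s ''m'' 0 = m" "m < T" and n: "1 \<le> n"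
  shows "wp egf_coeff_prog s (\<lambda>k s'. k \<le> 600 * (n * (T * T)) \<and>
    unchanged {''i'', ''j'', ''k''} {''acc'', ''pow'', ''f''} s s' \<and>
    real_mem s' ''f'' T = egf_coeff m v S n T)"
proof -
  let ?U = "unchanged {''i'', ''j'', ''k''} {''acc'', ''pow'', ''f''}"
  let ?I = "\<lambda>i s'. ?U s s' \<and> (\<forall>t\<le>T. real_mem s' ''f'' t = egf_coeff m v S i t)"
  have keep: "holds_input s' T n v S" if "?U s s'" for s'
    using input that by (rule holds_input_unchanged) auto
  have loop: "wp (For ''i'' (nvar ''n'') (Cond offered conv_row Skip)) s1
      (\<lambda>k s'. k \<le> (19 + 2 * ncost (nvar ''n'') + 464) * (n * (T * T)) \<and> ?I n s')"
    if s1: "unchanged {''j''} {''f''} s s1" "\<forall>t\<le>T. real_mem s1 ''f'' t = 1 / fact t" for s1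
  proof (rule wp_For[where I = "?I" and N = n])
    show "?I 0 (nat_write ''i'' 0 0 s1)" using s1 by (simp add: unchanged_def)
    show "nval (nvar ''n'') s' = n" if "?I i s'" for i s'
      using keep[of s'] that by (simp add: holds_input_def)
    have TT: "1 \<le> T * T" using m by simp
    show "n \<le> n" "1 \<le> n" "1 \<le> T * T" using n TT by auto
    show "wp (Cond offered conv_row Skip) s' (\<lambda>k s''. k \<le> 464 * (T * T) \<and>
        nat_mem s'' ''i'' 0 = i \<and> ?I (Suc i) (nat_write ''i'' 0 (Suc i) s''))"
      if "i < n" and I: "?I i s'" and i: "nat_mem s' ''i'' 0 = i" for i s'
    proof -
      have input': "holds_input s' T n v S" using keep I by blast
      then have offered: "bval offered s' \<longleftrightarrow> Suc i \<in> S"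
        using i \<open>i < n\<close> by (simp add: holds_input_def)
      show ?thesis
      proof (cases "Suc i \<in> S")
        case True
        have "wp conv_row s' (\<lambda>k s''. k \<le> 454 * (T * T) \<and>
          unchanged {''j'', ''k''} {''acc'', ''pow'', ''f''} s' s'' \<and>
          (\<forall>t\<le>T. real_mem s'' ''f'' t = truncated_conv m (v (Suc i)) (egf_coeff m v S i) t))"
        proof (rule conv_row)
          show "nat_mem s' ''m'' 0 = m" using I m by (simp add: unchanged_def)
          show "real_mem s' ''v'' (Suc (nat_mem s' ''i'' 0)) = v (Suc i)"
            using input' i \<open>i < n\<close> by (simp add: holds_input_def)
        qed (use input' I m in \<open>auto simp: holds_input_def\<close>)
        then show ?thesis
          unfolding wp_Cond offered if_P[OF True]
        proof (rule wp_mono)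
          fix k s''
          assume post: "k \<le> 454 * (T * T) \<and>
            unchanged {''j'', ''k''} {''acc'', ''pow'', ''f''} s' s'' \<and>
            (\<forall>t\<le>T. real_mem s'' ''f'' t = truncated_conv m (v (Suc i)) (egf_coeff m v S i) t)"
          have "1 + bcost offered + k = 8 + k" by simp
          with post TT have "1 + bcost offered + k \<le> 464 * (T * T)" by linarith
          then show "1 + bcost offered + k \<le> 464 * (T * T) \<and> nat_mem s'' ''i'' 0 = i \<and>
              ?I (Suc i) (nat_write ''i'' 0 (Suc i) s'')"
            using post I i True by (simp add: unchanged_def)
        qed
      next
        case False
        have "1 + bcost offered + 1 = 9" by simp
        with TT have "1 + bcost offered + 1 \<le> 464 * (T * T)" by linarith
        then show ?thesis
          unfolding wp_Cond offered if_not_P[OF False] wp_Skip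
          using I i False by (simp add: unchanged_def)
      qed
    qed
  qed
  have "1 * (T * 1) \<le> n * (T * T)"
    using n m by (intro mult_le_mono) auto
  then have q: "T \<le> n * (T * T)" by simp
  have cost: "1 + k1 + k2 \<le> 600 * (n * (T * T))"
    if "k1 \<le> 60 * T" "k2 \<le> (19 + 2 * ncost (nvar ''n'') + 464) * (n * (T * T))" for k1 k2
  proof -
    have "k2 \<le> 487 * (n * (T * T))" using that(2) by simp
    with that(1) q m(2) show ?thesis by linarith
  qed
  have "wp init_row s (\<lambda>k s'. k \<le> 60 * T \<and> unchanged {''j''} {''f''} s s' \<and>
    (\<forall>t\<le>T. real_mem s' ''f'' t = 1 / fact t))"
    by (rule init_row) (use input m in \<open>auto simp: holds_input_def\<close>)
  then show ?thesis
    unfolding egf_coeff_prog_def wp_Seq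
  proof (rule wp_mono)
    fix k1 s1
    assume post: "k1 \<le> 60 * T \<and> unchanged {''j''} {''f''} s s1 \<and>
      (\<forall>t\<le>T. real_mem s1 ''f'' t = 1 / fact t)"
    show "wp (For ''i'' (nvar ''n'') (Cond offered conv_row Skip)) s1
      (\<lambda>k2 s2. 1 + k1 + k2 \<le> 600 * (n * (T * T)) \<and> ?U s s2 \<and>
        real_mem s2 ''f'' T = egf_coeff m v S n T)"
      by (rule wp_mono[OF loop]) (use post cost in auto)
  qed
qed

definition normalise :: com where
  "normalise =
     Seq (rset ''W'' (ROfNat (NConst 1)))
    (Seq (For ''i'' (nvar ''n'')
           (Cond offered (rset ''W'' (RAdd (rvar ''W'') (RRead ''v'' (succ_var ''i'')))) Skip))
    (Seq (rset ''Z'' (ROfNat (NConst 1)))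
         (For ''j'' (nvar ''T'')
           (rset ''Z'' (RDiv (RMul (rvar ''Z'') (ROfNat (succ_var ''j''))) (rvar ''W''))))))"

lemma normalise:
  assumes input: "holds_input s T n v S" and S: "S \<subseteq> {1..n}" and "1 \<le> n" "1 \<le> T"
  shows "wp normalise s (\<lambda>k s'. k \<le> 120 * (n * T) \<and> unchanged {''i'', ''j''} {''W'', ''Z''} s s' \<and>
    real_mem s' ''Z'' 0 = fact T / (1 + weight v S) ^ T)"
proof -
  let ?U = "unchanged {''i'', ''j''} {''W'', ''Z''}"
  let ?I = "\<lambda>i s'. ?U s s' \<and> real_mem s' ''W'' 0 = 1 + weight v (S \<inter> {1..i})"
  let ?add = "Cond offered (rset ''W'' (RAdd (rvar ''W'') (RRead ''v'' (succ_var ''i'')))) Skip"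
  have keep: "holds_input s' T n v S" if "?U s s'" for s'
    using input that by (rule holds_input_unchanged) auto
  have weight_Suc: "weight v (S \<inter> {1..Suc i})
      = (if Suc i \<in> S then weight v (S \<inter> {1..i}) + v (Suc i) else weight v (S \<inter> {1..i}))" for i
  proof -
    have "S \<inter> {1..Suc i} = (if Suc i \<in> S then insert (Suc i) (S \<inter> {1..i}) else S \<inter> {1..i})"
      by (auto simp: le_Suc_eq)
    then show ?thesis by (simp add: weight_def)
  qed
  have sum_loop: "wp (For ''i'' (nvar ''n'') ?add) (real_write ''W'' 0 1 s)
      (\<lambda>k s'. k \<le> (19 + 2 * ncost (nvar ''n'') + 30) * (n * 1) \<and> ?I n s')"
  proof (rule wp_For[where I = "?I" and N = n])
    show "?I 0 (nat_write ''i'' 0 0 (real_write ''W'' 0 1 s))"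
      by (simp add: unchanged_def weight_def)
    show "nval (nvar ''n'') s' = n" if "?I i s'" for i s'
      using keep[of s'] that by (simp add: holds_input_def)
    show "wp ?add s' (\<lambda>k s''. k \<le> 30 * 1 \<and> nat_mem s'' ''i'' 0 = i \<and>
        ?I (Suc i) (nat_write ''i'' 0 (Suc i) s''))"
      if "i < n" and I: "?I i s'" and i: "nat_mem s' ''i'' 0 = i" for i s'
    proof -
      have "holds_input s' T n v S" using keep I by blast
      then have "bval offered s' \<longleftrightarrow> Suc i \<in> S" "real_mem s' ''v'' (Suc i) = v (Suc i)"
        using i \<open>i < n\<close> by (simp_all add: holds_input_def)
      then show ?thesis
        using I i by (simp add: unchanged_def weight_Suc[simplified] del: bval.simps)
    qed
  qed (use assms in auto)
  let ?J = "\<lambda>j s'. ?I n s' \<and> real_mem s' ''Z'' 0 = fact j / (1 + weight v S) ^ j"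
  let ?mult = "rset ''Z'' (RDiv (RMul (rvar ''Z'') (ROfNat (succ_var ''j''))) (rvar ''W''))"
  have prod_loop: "wp (For ''j'' (nvar ''T'') ?mult) (real_write ''Z'' 0 1 s')
      (\<lambda>k s''. k \<le> (19 + 2 * ncost (nvar ''T'') + 20) * (T * 1) \<and> ?J T s'')" if "?I n s'" for s'
  proof (rule wp_For[where I = "?J" and N = T])
    show "?J 0 (nat_write ''j'' 0 0 (real_write ''Z'' 0 1 s'))"
      using that by (simp add: unchanged_def)
    show "nval (nvar ''T'') s'' = T" if "?J j s''" for j s''
      using keep[of s''] that by (simp add: holds_input_def)
    show "wp ?mult s'' (\<lambda>k u. k \<le> 20 * 1 \<and> nat_mem u ''j'' 0 = j \<and>
        ?J (Suc j) (nat_write ''j'' 0 (Suc j) u))"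
      if "j < T" "?J j s''" "nat_mem s'' ''j'' 0 = j" for j s''
      using that S by (simp add: unchanged_def Int_absorb2 mult.commute)
  qed (use assms in auto)
  have sizes: "1 \<le> n * T" "n \<le> n * T" "T \<le> n * T"
    using assms by auto
  have cost: "11 + k1 + k2 \<le> 120 * (n * T)"
    if "k1 \<le> (19 + 2 * ncost (nvar ''n'') + 30) * (n * 1)"
      "k2 \<le> (19 + 2 * ncost (nvar ''T'') + 20) * (T * 1)" for k1 k2
  proof -
    have "k1 \<le> 53 * n" "k2 \<le> 43 * T" using that by simp_all
    with sizes show ?thesis by linarith
  qed
  from sum_loop have "wp (For ''i'' (nvar ''n'') ?add) (real_write ''W'' 0 1 s)
      (\<lambda>k1 s1. wp (For ''j'' (nvar ''T'') ?mult) (real_write ''Z'' 0 1 s1)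
        (\<lambda>k2 s2. 11 + k1 + k2 \<le> 120 * (n * T) \<and> ?J T s2))"
  proof (rule wp_mono)
    fix k1 s1
    assume "k1 \<le> (19 + 2 * ncost (nvar ''n'') + 30) * (n * 1) \<and> ?I n s1"
    then show "wp (For ''j'' (nvar ''T'') ?mult) (real_write ''Z'' 0 1 s1)
        (\<lambda>k2 s2. 11 + k1 + k2 \<le> 120 * (n * T) \<and> ?J T s2)"
      by (intro wp_mono[OF prod_loop]) (use cost in auto)
  qed
  then show ?thesis
    unfolding normalise_def by (auto elim!: wp_mono)
qed

definition expected_max_load_prog :: com where
  "expected_max_load_prog =
     Seq normalise
    (Seq (rset ''out'' (ROfNat (nvar ''T'')))
         (For ''m'' (nvar ''T'')
           (Seq egf_coeff_prog
                (rset ''out'' (RSub (rvar ''out'') (RMul (rvar ''Z'') (RRead ''f'' (nvar ''T''))))))))"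

lemma expected_max_load_prog:
  assumes input: "holds_input s T n v S" and S: "S \<subseteq> {1..n}" and "1 \<le> n" "1 \<le> T"
  shows "wp expected_max_load_prog s (\<lambda>k s'. k \<le> 1000 * (T * (n * (T * T))) \<and>
    result s' = real T - (\<Sum>m<T. fact T / (1 + weight v S) ^ T * egf_coeff m v S n T))"
proof -
  let ?z = "fact T / (1 + weight v S) ^ T"
  let ?U = "unchanged {''i'', ''j'', ''k'', ''m''} {''W'', ''Z'', ''acc'', ''pow'', ''f'', ''out''}"
  let ?I = "\<lambda>m s'. ?U s s' \<and> real_mem s' ''Z'' 0 = ?z \<and>
    real_mem s' ''out'' 0 = real T - (\<Sum>l<m. ?z * egf_coeff l v S n T)"
  let ?update = "rset ''out'' (RSub (rvar ''out'') (RMul (rvar ''Z'') (RRead ''f'' (nvar ''T''))))"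
  have keep: "holds_input s' T n v S" if "?U s s'" for s'
    using input that by (rule holds_input_unchanged) auto
  have loop: "wp (For ''m'' (nvar ''T'') (Seq egf_coeff_prog ?update)) (real_write ''out'' 0 (real T) s')
      (\<lambda>k s''. k \<le> (19 + 2 * ncost (nvar ''T'') + 620) * (T * (n * (T * T))) \<and> ?I T s'')"
    if s': "unchanged {''i'', ''j''} {''W'', ''Z''} s s'" "real_mem s' ''Z'' 0 = ?z" for s'
  proof (rule wp_For[where I = "?I" and N = T])
    show "?I 0 (nat_write ''m'' 0 0 (real_write ''out'' 0 (real T) s'))"
      using s' by (simp add: unchanged_def)
    show "nval (nvar ''T'') t = T" if "?I m t" for m t
      using keep[of t] that by (simp add: holds_input_def)
    have "1 * (1 * 1) \<le> n * (T * T)" by (intro mult_le_mono) (use assms in auto)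
    then show q: "1 \<le> n * (T * T)" by simp
    show "T \<le> T" "1 \<le> T" using assms by auto
    show "wp (Seq egf_coeff_prog ?update) t (\<lambda>k t'. k \<le> 620 * (n * (T * T)) \<and>
        nat_mem t' ''m'' 0 = m \<and> ?I (Suc m) (nat_write ''m'' 0 (Suc m) t'))"
      if "m < T" and I: "?I m t" and m: "nat_mem t ''m'' 0 = m" for m t
    proof -
      have input': "holds_input t T n v S" using keep I by blast
      have T: "nat_mem t' ''T'' 0 = T"
        if "unchanged {''i'', ''j'', ''k''} {''acc'', ''pow'', ''f''} t t'" for t'
        using input' that by (simp add: holds_input_def unchanged_def)
      have "wp egf_coeff_prog t (\<lambda>k t'. k \<le> 600 * (n * (T * T)) \<and>
          unchanged {''i'', ''j'', ''k''} {''acc'', ''pow'', ''f''} t t' \<and>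
          real_mem t' ''f'' T = egf_coeff m v S n T)"
        using input' m \<open>m < T\<close> \<open>1 \<le> n\<close> by (rule egf_coeff_prog)
      then show ?thesis
        unfolding wp_Seq wp_RWrite
      proof (rule wp_mono)
        fix k t'
        assume post: "k \<le> 600 * (n * (T * T)) \<and>
          unchanged {''i'', ''j'', ''k''} {''acc'', ''pow'', ''f''} t t' \<and>
          real_mem t' ''f'' T = egf_coeff m v S n T"
        let ?c = "1 + k + (1 + ncost (NConst 0) +
          rcost (RSub (rvar ''out'') (RMul (rvar ''Z'') (RRead ''f'' (nvar ''T'')))))"
        let ?t = "real_write ''out'' (nval (NConst 0) t')
          (rval (RSub (rvar ''out'') (RMul (rvar ''Z'') (RRead ''f'' (nvar ''T'')))) t') t'"
        have "?c = 12 + k" by simp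
        with post q have "?c \<le> 620 * (n * (T * T))" by linarith
        moreover have "nat_mem ?t ''m'' 0 = m" using post m by (simp add: unchanged_def)
        moreover have "?I (Suc m) (nat_write ''m'' 0 (Suc m) ?t)"
          using post I T[of t'] by (simp add: unchanged_def)
        ultimately show "?c \<le> 620 * (n * (T * T)) \<and> nat_mem ?t ''m'' 0 = m \<and>
          ?I (Suc m) (nat_write ''m'' 0 (Suc m) ?t)" by blast
      qed
    qed
  qed
  have "1 * (n * (1 * T)) \<le> T * (n * (T * T))"
    by (intro mult_le_mono) (use assms in auto)
  then have q: "n * T \<le> T * (n * (T * T))" by simp
  have one: "1 \<le> n * T" using assms by simp
  have cost: "10 + k1 + k2 \<le> 1000 * (T * (n * (T * T)))"
    if "k1 \<le> 120 * (n * T)" "k2 \<le> (19 + 2 * ncost (nvar ''T'') + 620) * (T * (n * (T * T)))"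
    for k1 k2
  proof -
    have "k2 \<le> 643 * (T * (n * (T * T)))" using that(2) by simp
    with that(1) q one show ?thesis by linarith
  qed
  from normalise[OF assms]
  have "wp normalise s (\<lambda>k1 s1.
      wp (For ''m'' (nvar ''T'') (Seq egf_coeff_prog ?update)) (real_write ''out'' 0 (real T) s1)
        (\<lambda>k2 s2. 10 + k1 + k2 \<le> 1000 * (T * (n * (T * T))) \<and> ?I T s2) \<and>
      nat_mem s1 ''T'' 0 = T)"
  proof (rule wp_mono)
    fix k1 s1
    assume post: "k1 \<le> 120 * (n * T) \<and> unchanged {''i'', ''j''} {''W'', ''Z''} s s1 \<and>
      real_mem s1 ''Z'' 0 = ?z"
    have "wp (For ''m'' (nvar ''T'') (Seq egf_coeff_prog ?update)) (real_write ''out'' 0 (real T) s1)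
        (\<lambda>k2 s2. 10 + k1 + k2 \<le> 1000 * (T * (n * (T * T))) \<and> ?I T s2)"
      by (rule wp_mono[OF loop]) (use post cost in auto)
    then show "wp (For ''m'' (nvar ''T'') (Seq egf_coeff_prog ?update)) (real_write ''out'' 0 (real T) s1)
        (\<lambda>k2 s2. 10 + k1 + k2 \<le> 1000 * (T * (n * (T * T))) \<and> ?I T s2) \<and>
      nat_mem s1 ''T'' 0 = T"
      using post input by (simp add: unchanged_def holds_input_def)
  qed
  then show ?thesis
    unfolding expected_max_load_prog_def wp_Seq[of normalise] wp_Seq[of "rset ''out'' e" for e] wp_RWrite
    by (rule wp_mono) (auto simp: result_def elim!: wp_mono)
qed

theorem theorem3p1:
  shows "\<exists>(prog :: com) (C :: nat).
    \<forall>(T :: nat) (n :: nat) (v :: nat \<Rightarrow> real) (S :: nat set) (s :: state).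
      1 \<le> T \<longrightarrow> 1 \<le> n \<longrightarrow> (\<forall>i\<in>{1..n}. 0 < v i) \<longrightarrow> S \<subseteq> {1..n} \<longrightarrow> holds_input s T n v S \<longrightarrow>
      (\<exists>(k :: nat) (s' :: state).
        exec prog s k s' \<and> result s' = expected_max_load T v S \<and> k \<le> C * (n ^ 2 * T ^ 3))"
proof (rule exI[of _ expected_max_load_prog], rule exI[of _ 1000], intro allI impI)
  fix T n :: nat and v :: "nat \<Rightarrow> real" and S :: "nat set" and s :: state
  assume T: "1 \<le> T" and n: "1 \<le> n" and v: "\<forall>i\<in>{1..n}. 0 < v i" and S: "S \<subseteq> {1..n}"
    and input: "holds_input s T n v S"
  obtain k s' where run: "exec expected_max_load_prog s k s'" "k \<le> 1000 * (T * (n * (T * T)))"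
    and res: "result s' = real T - (\<Sum>m<T. fact T / (1 + weight v S) ^ T * egf_coeff m v S n T)"
    using expected_max_load_prog[OF input S n T] unfolding wp_def by blast
  have "T * (n * (T * T)) = n ^ 1 * T ^ 3" by (simp add: power3_eq_cube)
  also have "\<dots> \<le> n ^ 2 * T ^ 3"
    using n by (intro mult_le_mono1 power_increasing) auto
  finally have "k \<le> 1000 * (n ^ 2 * T ^ 3)" using run(2) by linarith
  then show "\<exists>k s'. exec expected_max_load_prog s k s' \<and> result s' = expected_max_load T v S \<and>
      k \<le> 1000 * (n ^ 2 * T ^ 3)"
    using run(1) res expected_max_load_eq[OF S v] by auto
qed

end
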